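(* For every integer $n \geq 2$ with $n \equiv 2 \pmod 4$, the $n$-dimensional balanced shuffle-cube $BSQ_n$ is vertex-bipancyclic, i.e. for every vertex $u$ of $BSQ_n$ and every even integer $l$ with $4 \leq l \leq |V(BSQ_n)| = 2^n$, there is a cycle of length $l$ in $BSQ_n$ that contains $u$.
   Context: All graphs are finite, simple and undirected. The length of a cycle is its number of edges. Notation for binary strings $u = u_{n-1}u_{n-2}\ldots u_1u_0$: the $4$-prefix is $p_4(u) = u_{n-1}u_{n-2}u_{n-3}u_{n-4}$ and the $(n-4)$-suffix is $s_{n-4}(u) = u_{n-5}\ldots u_1u_0$. The balanced shuffle-cube $BSQ_n$ is defined recursively for $n \equiv 2 \pmod 4$, $n \geq 2$; its vertices are all $2^n$ $n$-bit binary strings. $BSQ_2 = Q_2$ is the $4$-cycle on the strings $00,01,10,11$, two strings being adjacent iff they differ in exactly one bit. For $n > 2$, $BSQ_n$ is obtained from sixteen copies $BSQ_{n-4}^{i_1i_2i_3i_4}$ of $BSQ_{n-4}$, one for each $i_1,i_2,i_3,i_4 \in \{0,1\}$; the vertices of $BSQ_{n-4}^{i_1i_2i_3i_4}$ are the strings $u$ with $p_4(u) = i_1i_2i_3i_4$, and two vertices of the same copy are adjacent iff their $(n-4)$-suffixes are adjacent in $BSQ_{n-4}$. Two vertices $u,v$ in different copies are adjacent in $BSQ_n$ iff all of the following hold: (1) $s_{n-4}(u) = s_{n-4}(v)$; (2) $u_{n-2}$ and $v_{n-2}$ have different parities, and $v_{n-1}v_{n-2} = u_{n-1}u_{n-2}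 \pm 1$; (3) $v_{n-3}v_{n-4} = u_{n-3}u_{n-4} + (-1)^{u_{n-2}}$ or $v_{n-3}v_{n-4} = u_{n-3}u_{n-4}$. Here a pair of bits $ab$ is regarded as the integer $2a+b$, and addition and subtraction are modulo $4$. The graph $BSQ_n$ is bipartite. *)

theory Defs
  imports "Graph_Theory.Pair_Digraph"
begin

text \<open>
  An \<open>n\<close>-bit string \<open>u\<^bsub>n-1\<^esub> \<dots> u\<^bsub>1\<^esub> u\<^bsub>0\<^esub>\<close> is a list of Booleans with \<open>u\<^bsub>n-1\<^esub>\<close> at its head;
  \<open>str_bit u i\<close> is the digit \<open>u\<^bsub>i\<^esub>\<close>.  The prefix \<open>p\<^sub>4(u)\<close> is \<open>take 4 u\<close> and the suffix
  \<open>s\<^bsub>n-4\<^esub>(u)\<close> is \<open>drop 4 u\<close>.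
\<close>

definition str_bit :: "bool list \<Rightarrow> nat \<Rightarrow> nat" where
  "str_bit u i = of_bool (u ! (length u - Suc i))"

definition bit_pair :: "bool list \<Rightarrow> nat \<Rightarrow> nat \<Rightarrow> int" where
  "bit_pair u i j = 2 * int (str_bit u i) + int (str_bit u j)"

definition bsq_cross :: "nat \<Rightarrow> bool list \<Rightarrow> bool list \<Rightarrow> bool" where
  "bsq_cross n u v \<longleftrightarrow>
     drop 4 u = drop 4 v \<and>
     (odd (str_bit u (n - 2)) \<noteq> odd (str_bit v (n - 2)) \<and>
       (bit_pair v (n - 1) (n - 2) = (bit_pair u (n - 1) (n - 2) + 1) mod 4 \<or>
        bit_pair v (n - 1) (n - 2) = (bit_pair u (n - 1) (n - 2) - 1) mod 4)) \<and>
     (bit_pair v (n - 3) (n - 4) =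
        (bit_pair u (n - 3) (n - 4) + (- 1) ^ str_bit u (n - 2)) mod 4 \<or>
      bit_pair v (n - 3) (n - 4) = bit_pair u (n - 3) (n - 4))"

text \<open>Only the values at \<open>n \<equiv> 2 (mod 4)\<close> are meaningful.\<close>

fun bsq_adj :: "nat \<Rightarrow> bool list \<Rightarrow> bool list \<Rightarrow> bool" where
  "bsq_adj n u v =
     (if n \<le> 2 then card {i. i < n \<and> str_bit u i \<noteq> str_bit v i} = 1
      else if take 4 u = take 4 v then bsq_adj (n - 4) (drop 4 u) (drop 4 v)
      else bsq_cross n u v)"

declare bsq_adj.simps [simp del]

text \<open>A simple undirected graph is a finite loop-free symmetric digraph (\<^locale>\<open>pair_graph\<close>).\<close>

definition BSQ :: "nat \<Rightarrow> bool list pair_pre_digraph" where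
  "BSQ n = \<lparr> pverts = {u. length u = n},
             parcs = {(u, v). length u = n \<and> length v = n \<and> bsq_adj n u v} \<rparr>"

text \<open>
  In a symmetric digraph \<^const>\<open>pre_digraph.cycle\<close> also admits an edge traversed back and forth, of
  length 2.  From length 3 on, it describes exactly the cycles of the undirected graph.
\<close>

definition vertex_bipancyclic :: "('a, 'b) pre_digraph \<Rightarrow> bool" where
  "vertex_bipancyclic G \<longleftrightarrow>
     (\<forall>u \<in> verts G. \<forall>l. even l \<and> 4 \<le> l \<and> l \<le> card (verts G) \<longrightarrow>
        (\<exists>p. pre_digraph.cycle G p \<and> length p = l \<and> u \<in> tail G ` set p))"

lemma card_verts_BSQ: "card (verts (with_proj (BSQ n))) = 2 ^ n"
  using card_lists_length_eq[of "UNIV :: bool set" n] by (simp add: BSQ_def)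

lemma bit_pair_bounds: "0 \<le> bit_pair u i j" "bit_pair u i j < 4"
  by (auto simp: bit_pair_def str_bit_def of_bool_def)

lemma bit_pair_shift:
  assumes "bit_pair v i j = (bit_pair u i j + c) mod 4"
  shows "bit_pair u i j = (bit_pair v i j - c) mod 4"
proof -
  have "(bit_pair v i j - c) mod 4 = bit_pair u i j mod 4"
    unfolding assms mod_diff_left_eq by simp
  then show ?thesis
    using bit_pair_bounds[of u i j] by (simp only: mod_pos_pos_trivial)
qed

lemma sign_str_bit:
  assumes "odd (str_bit u i) \<noteq> odd (str_bit v i)"
  shows "(- 1 :: int) ^ str_bit v i = - ((- 1) ^ str_bit u i)"
  using assms by (auto simp: str_bit_def of_bool_def split: if_splits)

lemma bsq_cross_sym:
  assumes "bsq_cross n u v"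
  shows "bsq_cross n v u"
proof -
  define e :: int where "e = (- 1) ^ str_bit u (n - 2)"
  note uv = assms[unfolded bsq_cross_def, folded e_def]
  from uv have drop: "drop 4 v = drop 4 u"
    and odd: "odd (str_bit v (n - 2)) \<noteq> odd (str_bit u (n - 2))"
    by (metis, metis)
  have sgn: "(- 1) ^ str_bit v (n - 2) = - e"
    unfolding e_def by (rule sign_str_bit) (use odd in metis)
  have "bit_pair u (n - 1) (n - 2) = (bit_pair v (n - 1) (n - 2) + 1) mod 4 \<or>
      bit_pair u (n - 1) (n - 2) = (bit_pair v (n - 1) (n - 2) - 1) mod 4"
    using uv bit_pair_shift[of v "n - 1" "n - 2" u 1] bit_pair_shift[of v "n - 1" "n - 2" u "- 1"]
    unfolding diff_minus_eq_add add_uminus_conv_diff by blast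
  moreover have "bit_pair u (n - 3) (n - 4) = (bit_pair v (n - 3) (n - 4) + - e) mod 4 \<or>
      bit_pair u (n - 3) (n - 4) = bit_pair v (n - 3) (n - 4)"
    using uv bit_pair_shift[of v "n - 3" "n - 4" u e]
    unfolding add_uminus_conv_diff by metis
  ultimately show ?thesis
    unfolding bsq_cross_def sgn using drop odd by blast
qed

lemma bsq_adj_base:
  "n \<le> 2 \<Longrightarrow> bsq_adj n u v \<longleftrightarrow> card {i. i < n \<and> str_bit u i \<noteq> str_bit v i} = 1"
  by (subst bsq_adj.simps) (rule if_P)

lemma bsq_adj_same_copy:
  "n > 2 \<Longrightarrow> take 4 u = take 4 v \<Longrightarrow>
     bsq_adj n u v \<longleftrightarrow> bsq_adj (n - 4) (drop 4 u) (drop 4 v)"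
  by (subst bsq_adj.simps) (simp only: not_le[symmetric] if_False if_True simp_thms)

lemma bsq_adj_different_copies:
  "n > 2 \<Longrightarrow> take 4 u \<noteq> take 4 v \<Longrightarrow> bsq_adj n u v \<longleftrightarrow> bsq_cross n u v"
  by (subst bsq_adj.simps) (simp only: not_le[symmetric] if_False)

lemma bsq_adj_sym: "bsq_adj n u v \<Longrightarrow> bsq_adj n v u"
proof (induction n arbitrary: u v rule: less_induct)
  case (less n)
  consider "n \<le> 2" | "n > 2" "take 4 u = take 4 v" | "n > 2" "take 4 u \<noteq> take 4 v"
    by linarith
  then show ?case
  proof cases
    case a: 1
    have "{i. i < n \<and> str_bit u i \<noteq> str_bit v i} = {i. i < n \<and> str_bit v i \<noteq> str_bit u i}"
      by auto
    with less.prems show ?thesis unfolding bsq_adj_base[OF a] by argo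
  next
    case a: 2
    have "n - 4 < n" using a(1) by linarith
    moreover have "bsq_adj (n - 4) (drop 4 u) (drop 4 v)"
      using less.prems unfolding bsq_adj_same_copy[OF a] .
    ultimately show ?thesis
      unfolding bsq_adj_same_copy[OF a(1) a(2)[symmetric]] by (rule less.IH)
  next
    case a: 3
    show ?thesis
      unfolding bsq_adj_different_copies[OF a(1) a(2)[symmetric]]
      using less.prems unfolding bsq_adj_different_copies[OF a] by (rule bsq_cross_sym)
  qed
qed

lemma bsq_adj_irrefl: "\<not> bsq_adj n u u"
proof (induction n arbitrary: u rule: less_induct)
  case (less n)
  show ?case
  proof (cases "n \<le> 2")
    case True
    then show ?thesis by (simp add: bsq_adj_base)
  next
    case False
    then have n: "n > 2" "n - 4 < n" by linarith+
    show ?thesis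
      unfolding bsq_adj_same_copy[OF n(1) refl] by (rule less.IH[OF n(2)])
  qed
qed

lemma pair_graph_BSQ: "pair_graph (BSQ n)"
proof -
  have fin: "finite {u :: bool list. length u = n}"
    using finite_lists_length_eq[of "UNIV :: bool set" n] by simp
  have verts: "pverts (BSQ n) = {u. length u = n}"
    by (simp add: BSQ_def)
  have arcs: "(u, v) \<in> parcs (BSQ n) \<longleftrightarrow> length u = n \<and> length v = n \<and> bsq_adj n u v" for u v
    by (simp add: BSQ_def)
  have "parcs (BSQ n) \<subseteq> {u. length u = n} \<times> {u. length u = n}"
    by (auto simp: BSQ_def)
  then have fin_arcs: "finite (parcs (BSQ n))"
    using fin finite_subset by blast
  have sym: "sym (parcs (BSQ n))"
    by (rule symI) (metis arcs bsq_adj_sym)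
  show ?thesis
  proof
    fix e assume e: "e \<in> parcs (BSQ n)"
    obtain u v where uv: "e = (u, v)" by (cases e)
    show "fst e \<in> pverts (BSQ n)" "snd e \<in> pverts (BSQ n)" "fst e \<noteq> snd e"
      using e bsq_adj_irrefl[of n u] unfolding uv arcs verts by auto
  next
    show "finite (pverts (BSQ n))" using fin verts by simp
  next
    show "finite (parcs (BSQ n))" by (rule fin_arcs)
  next
    show "symmetric (with_proj (BSQ n))" using sym by (simp add: symmetric_def)
  qed
qed

end

theory Submission
  imports Defs "Graph_Theory.Vertex_Walk"
begin

text \<open>
  Conditions (2) and (3) only concern the \<open>4\<close>-prefixes, so \<open>BSQ\<^bsub>n\<^esub>\<close> is the Cartesian product of
  \<open>BSQ\<^bsub>n-4\<^esub>\<close> with a fixed graph \<open>H\<close> on the sixteen prefixes.  The graph \<open>H\<close> has a Hamiltonian cycle,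
  and by induction so does \<open>BSQ\<^bsub>n-4\<^esub>\<close>.  Cutting both cycles open at the coordinates of a given vertex
  \<open>u\<close> yields a \<open>16 \<times> 2\<^bsup>n-4\<^esup>\<close> grid in \<open>BSQ\<^bsub>n\<^esub>\<close> with \<open>u\<close> in its corner.  In a grid with an even
  number of rows and at least three columns, every even length up to the number of vertices is
  realised by a comb through the corner: up along column \<open>0\<close>, then back through pairs of rows,
  reaching out into each pair as far as desired.
\<close>

section \<open>Cycles as vertex lists\<close>

text \<open>The first vertex is not repeated at the end of the list, so the length of the list is
  the length of the cycle. A two-element list traversing one edge back and forth also qualifies;
  every length used below is at least 4.\<close>

definition vertex_cycle :: "('a \<Rightarrow> 'a \<Rightarrow> bool) \<Rightarrow> 'a list \<Rightarrow> bool" where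
  "vertex_cycle R vs \<longleftrightarrow> vs \<noteq> [] \<and> distinct vs \<and> successively R (vs @ [hd vs])"

text \<open>Swapping the two pieces of the list around \<open>u\<close> moves \<open>u\<close> to
  index 0, which later becomes the corner of the grid.\<close>

lemma vertex_cycle_rotate_to:
  assumes "vertex_cycle R vs" and "u \<in> set vs"
  obtains ws where "vertex_cycle R (u # ws)" "length (u # ws) = length vs" "set (u # ws) = set vs"
proof -
  obtain xs ys where vs: "vs = xs @ u # ys"
    using assms(2) by (auto simp: in_set_conv_decomp)
  show thesis
  proof (rule that)
    show "vertex_cycle R (u # (ys @ xs))"
      using assms(1) unfolding vs vertex_cycle_def
      by (cases xs) (auto simp: successively_append_iff successively_Cons hd_append)
  qed (auto simp: vs)
qed

lemma vertex_cycle_map: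
  assumes "vertex_cycle R vs" and "inj_on f (set vs)"
    and "\<And>x y. x \<in> set vs \<Longrightarrow> y \<in> set vs \<Longrightarrow> R x y \<Longrightarrow> S (f x) (f y)"
  shows "vertex_cycle S (map f vs)"
proof -
  have ne: "vs \<noteq> []" and "successively R (vs @ [hd vs])"
    using assms(1) by (auto simp: vertex_cycle_def)
  from this(2) have "successively (\<lambda>x y. S (f x) (f y)) (vs @ [hd vs])"
    by (rule successively_mono) (use ne in \<open>auto intro: assms(3)\<close>)
  then have "successively S (map f (vs @ [hd vs]))"
    by (simp only: successively_map)
  then show ?thesis
    using assms(1,2) ne by (simp add: vertex_cycle_def distinct_map hd_map)
qed

lemma pcas_vwalk_arcs: "pcas u (vwalk_arcs (u # vs)) (last (u # vs))"
  by (induction vs arbitrary: u) auto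

lemma pawalk_verts_vwalk_arcs: "pawalk_verts u (vwalk_arcs (u # vs)) = u # vs"
  by (induction vs arbitrary: u) auto

lemma set_vwalk_arcs_subset_iff:
  "set (vwalk_arcs vs) \<subseteq> A \<longleftrightarrow> successively (\<lambda>x y. (x, y) \<in> A) vs"
  by (induction vs rule: vwalk_arcs.induct) auto

lemma fst_set_vwalk_arcs: "fst ` set (vwalk_arcs (vs @ [v])) = set vs"
proof (induction vs)
  case (Cons a vs)
  then show ?case by (cases vs) auto
qed auto

text \<open>The closing vertex appears at both ends of the walk, and the library's
  \<open>cycle\<close> demands distinctness only of the tail of its vertex list, here
  \<open>ws @ [v]\<close>.\<close>

lemma cycle_vwalk_arcs:
  assumes "vertex_cycle (\<lambda>x y. (x, y) \<in> parcs G) vs" and "set vs \<subseteq> pverts G"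
  shows "pre_digraph.cycle (with_proj G) (vwalk_arcs (vs @ [hd vs]))"
proof -
  obtain v ws where vs: "vs = v # ws"
    using assms(1) by (cases vs) (auto simp: vertex_cycle_def)
  let ?p = "vwalk_arcs (v # (ws @ [v]))"
  have "pcas v ?p v"
    using pcas_vwalk_arcs[of v "ws @ [v]"] by simp
  moreover have "set ?p \<subseteq> parcs G"
    unfolding set_vwalk_arcs_subset_iff using assms(1) by (simp add: vs vertex_cycle_def)
  moreover have "distinct (tl (pawalk_verts v ?p))"
    unfolding pawalk_verts_vwalk_arcs using assms(1) by (simp add: vs vertex_cycle_def)
  ultimately have "pre_digraph.cycle (with_proj G) ?p"
    using assms(2) unfolding pre_digraph.cycle_def pre_digraph.awalk_def
    by (auto simp: vs cas_with_proj_eq awalk_verts_with_proj_eq)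
  then show ?thesis by (simp add: vs)
qed

section \<open>Cycles in grids\<close>

fun grid_adj :: "nat \<times> nat \<Rightarrow> nat \<times> nat \<Rightarrow> bool" where
  "grid_adj (i, j) (i', j') \<longleftrightarrow>
     i = i' \<and> (j' = Suc j \<or> j = Suc j') \<or> j = j' \<and> (i' = Suc i \<or> i = Suc i')"

lemma successively_upt:
  assumes "\<And>i. m \<le> i \<Longrightarrow> Suc i < n \<Longrightarrow> P i (Suc i)"
  shows "successively P [m..<n]"
  unfolding successively_conv_nth using assms by auto

text \<open>A path out along one row and back along the next visits any even number of cells from 2
  to \<open>2 * c\<close>, so \<open>r\<close> row pairs can be tuned to any half-length
  \<open>s\<close> from \<open>r\<close> to \<open>r * c\<close>. Column 0 stays free for the way
  back.\<close>

lemma grid_snake: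
  assumes "r \<le> s" and "s \<le> r * c" and "1 \<le> c"
  shows "\<exists>xs. successively grid_adj xs \<and> distinct xs \<and> length xs = 2 * s \<and>
           set xs \<subseteq> {..<2 * r} \<times> {1..c} \<and>
           (r > 0 \<longrightarrow> hd xs = (0, 1) \<and> last xs = (2 * r - 1, 1))"
  using assms(1,2)
proof (induction r arbitrary: s)
  case 0
  then show ?case by (intro exI[of _ "[]"]) auto
next
  case (Suc r)
  \<comment> \<open>The last row pair takes as many columns as possible while leaving at least one
    for each of the other \<open>r\<close> pairs.\<close>
  define t where "t = min c (s - r)"
  have t: "1 \<le> t" "t \<le> c" "t \<le> s" "r \<le> s - t"
    using Suc.prems assms(3) by (auto simp: t_def)
  have "r \<le> r * c" using assms(3) by simp
  then have "s - t \<le> r * c"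
    using Suc.prems by (cases "c \<le> s - r") (auto simp: t_def min_def)
  with Suc.IH[OF t(4)] obtain xs where
    xs: "successively grid_adj xs" "distinct xs" "length xs = 2 * (s - t)"
      "set xs \<subseteq> {..<2 * r} \<times> {1..c}" "r > 0 \<longrightarrow> hd xs = (0, 1) \<and> last xs = (2 * r - 1, 1)"
    by blast
  define ys where
    "ys = map (Pair (2 * r)) [1..<Suc t] @ rev (map (Pair (Suc (2 * r))) [1..<Suc t])"
  have hd_ys: "hd ys = (2 * r, 1)" and last_ys: "last ys = (Suc (2 * r), 1)"
    using t(1) by (auto simp: ys_def hd_append hd_map last_rev simp del: upt_Suc)
  have succ_ys: "successively grid_adj ys"
    using t(1) unfolding ys_def
    by (auto simp: successively_append_iff successively_map hd_rev last_map
        intro!: successively_upt simp del: upt_Suc)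
  have ys: "distinct ys" "length ys = 2 * t" "set ys \<subseteq> {2 * r..<2 * Suc r} \<times> {1..c}"
    using t(2) by (auto simp: ys_def distinct_map inj_on_def simp del: upt_Suc)
  have "ys \<noteq> []" using t(1) ys(2) by auto
  show ?case
  proof (intro exI[of _ "xs @ ys"] conjI impI)
    have "grid_adj (last xs) (hd ys)" if "xs \<noteq> []"
    proof -
      from that xs(4) have "r > 0" by (cases r) auto
      then show ?thesis using xs(5) hd_ys by auto
    qed
    then show "successively grid_adj (xs @ ys)"
      using xs(1) succ_ys by (auto simp: successively_append_iff)
    show "distinct (xs @ ys)"
      using xs(2,4) ys(1,3) by fastforce
    show "length (xs @ ys) = 2 * s"
      using xs(3) ys(2) t(3) by auto
    have "{..<2 * r} \<times> {1..c} \<subseteq> {..<2 * Suc r} \<times> {1..c}"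
      "{2 * r..<2 * Suc r} \<times> {1..c} \<subseteq> {..<2 * Suc r} \<times> {1..c}" by auto
    with xs(4) ys(3) show "set (xs @ ys) \<subseteq> {..<2 * Suc r} \<times> {1..c}"
      unfolding set_append by blast
    show "last (xs @ ys) = (2 * Suc r - 1, 1)"
      using \<open>ys \<noteq> []\<close> last_ys by simp
    show "hd (xs @ ys) = (0, 1)"
    proof (cases "r = 0")
      case True
      then have "xs = []" using xs(4) by auto
      then show ?thesis using True hd_ys by simp
    next
      case False
      then have "xs \<noteq> []" using xs(3) t(4) by auto
      then show ?thesis using False xs(5) by simp
    qed
  qed
qed

text \<open>Column 0 of the first \<open>2 * r\<close> rows is closed up by a snake through the same
  rows; the task is to choose \<open>r\<close> so that the snake has an admissible length.\<close>

lemma grid_even_cycle: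
  assumes "3 \<le> b" and "even l" and "4 \<le> l" and "l \<le> 2 * k * b"
  shows "\<exists>vs. vertex_cycle grid_adj vs \<and> length vs = l \<and> (0, 0) \<in> set vs \<and>
           set vs \<subseteq> {..<2 * k} \<times> {..<b}"
proof -
  obtain h where l: "l = 2 * h" using assms(2) by blast
  have h: "2 \<le> h" "h \<le> k * b" using assms(3,4) by (auto simp: l)
  \<comment> \<open>Being large enough gives the upper bound \<open>h - r \<le> r * (b - 1)\<close>.
    Minimality gives \<open>(r - 1) * b < h\<close>, hence \<open>3 * (r - 1) < h\<close>, and with
    \<open>2 \<le> h\<close> this yields the lower bound \<open>r \<le> h - r\<close>.\<close>
  define r where "r = (LEAST r. h \<le> r * b)"
  have hr: "h \<le> r * b" and "r \<le> k"
    unfolding r_def using h(2) by (rule LeastI, intro Least_le)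
  have "r > 0" using hr h(1) by (cases r) auto
  have "\<not> h \<le> (r - 1) * b"
    unfolding r_def by (rule not_less_Least) (use \<open>r > 0\<close> in \<open>simp add: r_def\<close>)
  moreover have "(r - 1) * 3 \<le> (r - 1) * b" using assms(1) by simp
  ultimately have r2: "2 * r \<le> h" using h(1) \<open>r > 0\<close> by linarith
  have "r \<le> h - r" "h - r \<le> r * (b - 1)" "1 \<le> b - 1"
    using hr r2 assms(1) by (simp_all add: diff_mult_distrib2)
  then obtain xs where
    xs: "successively grid_adj xs" "distinct xs" "length xs = 2 * (h - r)"
      "set xs \<subseteq> {..<2 * r} \<times> {1..b - 1}" "hd xs = (0, 1)" "last xs = (2 * r - 1, 1)"
    using grid_snake[of r "h - r" "b - 1"] \<open>r > 0\<close> by blast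
  define ys where "ys = rev (map (\<lambda>i. (i, 0 :: nat)) [0..<2 * r])"
  have hd_ys: "hd ys = (2 * r - 1, 0)" and last_ys: "last ys = (0, 0)"
    using \<open>r > 0\<close> by (auto simp: ys_def hd_rev last_rev last_map hd_map)
  have succ_ys: "successively grid_adj ys"
    unfolding ys_def by (auto simp: successively_map intro!: successively_upt)
  have ys: "distinct ys" "length ys = 2 * r" "set ys = {..<2 * r} \<times> {0}"
    by (auto simp: ys_def distinct_map inj_on_def)
  have ne: "xs \<noteq> []" "ys \<noteq> []" using xs(3) ys(2) r2 \<open>r > 0\<close> by auto
  show ?thesis
  proof (intro exI[of _ "ys @ xs"] conjI)
    have "distinct (ys @ xs)" using xs(2,4) ys(1,3) by auto
    then show "vertex_cycle grid_adj (ys @ xs)"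
      using xs(1,5,6) succ_ys hd_ys last_ys ne
      by (auto simp: vertex_cycle_def successively_append_iff)
    show "length (ys @ xs) = l" using xs(3) ys(2) r2 by (simp add: l)
    show "(0, 0) \<in> set (ys @ xs)" using ys(3) \<open>r > 0\<close> by simp
    have "{..<2 * r} \<subseteq> {..<2 * k}" "{1..b - 1} \<subseteq> {..<b}" "0 < b"
      using \<open>r \<le> k\<close> assms(1) by auto
    then show "set (ys @ xs) \<subseteq> {..<2 * k} \<times> {..<b}"
      using xs(4) ys(3) by fastforce
  qed
qed

section \<open>Product structure of the balanced shuffle-cube\<close>

lemma str_bit_append:
  assumes "length v = n" "k < length p"
  shows "str_bit (p @ v) (n + k) = str_bit p k"
proof -
  have "length (p @ v) - Suc (n + k) = length p - Suc k" "length p - Suc k < length p"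
    using assms by auto
  then show ?thesis
    unfolding str_bit_def by (simp only: nth_append if_True)
qed

text \<open>With equal suffixes only the top four digits matter, so \<open>bsq_cross 4\<close> on
  bare prefixes serves as the edge relation of the factor graph \<open>H\<close>.\<close>

lemma bsq_cross_append:
  assumes "length p = 4" "length q = 4" "length s = n"
  shows "bsq_cross (n + 4) (p @ s) (q @ s) \<longleftrightarrow> bsq_cross 4 p q"
proof -
  have *: "n + 4 - 1 = n + 3" "n + 4 - 2 = n + 2" "n + 4 - 3 = n + 1" "n + 4 - 4 = n + 0"
    "(4::nat) - 1 = 3" "(4::nat) - 2 = 2" "(4::nat) - 3 = 1" "(4::nat) - 4 = 0"
    by simp_all
  have bit: "str_bit (p @ s) (n + k) = str_bit p k" "str_bit (q @ s) (n + k) = str_bit q k"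
    if "k < 4" for k
    using that assms by (simp_all add: str_bit_append)
  have "drop 4 (p @ s) = drop 4 (q @ s) \<longleftrightarrow> drop 4 p = drop 4 q"
    using assms by simp
  moreover have "(0::nat) < 4" "(1::nat) < 4" "(2::nat) < 4" "(3::nat) < 4"
    by simp_all
  note bit[OF this(1)] bit[OF this(2)] bit[OF this(3)] bit[OF this(4)]
  ultimately show ?thesis
    unfolding bsq_cross_def bit_pair_def * by (simp only:)
qed

lemma bsq_adj_append_same:
  "length p = 4 \<Longrightarrow> bsq_adj (n + 4) (p @ s) (p @ t) \<longleftrightarrow> bsq_adj n s t"
  by (simp add: bsq_adj_same_copy)

lemma bsq_adj_append_cross:
  assumes "length p = 4" "length q = 4" "length s = n" "bsq_cross 4 p q"
  shows "bsq_adj (n + 4) (p @ s) (q @ s)"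
proof -
  have "p \<noteq> q" using assms(4) by (auto simp: bsq_cross_def)
  then show ?thesis
    using assms by (simp add: bsq_adj_different_copies bsq_cross_append)
qed

text \<open>The upper pair increases by 1 modulo 4 at each step. The lower pair is constant on
  blocks of four and drops by 1 modulo 4 when the upper pair passes from 11 to 00, where the sign in
  condition (3) is negative; the closing edge is of this kind too.\<close>

definition prefix_cycle :: "bool list list" where
  "prefix_cycle =
     [[False, False, False, False], [False, True, False, False],
      [True, False, False, False], [True, True, False, False],
      [False, False, True, True], [False, True, True, True],
      [True, False, True, True], [True, True, True, True],
      [False, False, True, False], [False, True, True, False],
      [True, False, True, False], [True, True, True, False],
      [False, False, False, True], [False, True, False, True],
      [True, False, False, True], [True, True, False, True]]"

lemma length_prefix_cycle: "length prefix_cycle = 16"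
  by (simp add: prefix_cycle_def)

lemma vertex_cycle_prefix_cycle: "vertex_cycle (bsq_cross 4) prefix_cycle"
  by (simp add: vertex_cycle_def prefix_cycle_def bsq_cross_def bit_pair_def str_bit_def
      eval_nat_numeral)

lemma set_prefix_cycle: "set prefix_cycle = {p. length p = 4}"
proof
  show "set prefix_cycle \<subseteq> {p. length p = 4}"
    by (simp add: prefix_cycle_def)
  show "{p. length p = 4} \<subseteq> set prefix_cycle"
  proof
    fix p :: "bool list" assume "p \<in> {p. length p = 4}"
    then obtain a b c d where "p = [a, b, c, d]"
      by (auto simp: eval_nat_numeral length_Suc_conv)
    then show "p \<in> set prefix_cycle"
      by (cases a; cases b; cases c; cases d) (simp_all add: prefix_cycle_def)
  qed
qed

section \<open>Induction on the dimension in steps of four\<close>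

lemma BSQ_2_cycle:
  assumes "length u = 2"
  shows "\<exists>vs. vertex_cycle (bsq_adj 2) vs \<and> length vs = 4 \<and> u \<in> set vs \<and>
           set vs \<subseteq> {v. length v = 2}"
proof -
  define vs where "vs = [[False, False], [False, True], [True, True], [True, False]]"
  \<comment> \<open>Makes the set of differing positions explicit, so that its cardinality can be
    computed.\<close>
  have "{i. i < 2 \<and> P i} = (if P 0 then {0} else {}) \<union> (if P 1 then {1} else {})"
    for P :: "nat \<Rightarrow> bool"
    by (auto simp: less_2_cases_iff split: if_splits intro: gr0I)
  then have "vertex_cycle (bsq_adj 2) vs"
    by (simp add: vs_def vertex_cycle_def bsq_adj_base str_bit_def)
  moreover obtain a b where "u = [a, b]"
    using assms by (auto simp: eval_nat_numeral length_Suc_conv)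
  then have "u \<in> set vs" by (cases a; cases b) (simp_all add: vs_def)
  ultimately show ?thesis
    by (intro exI[of _ vs]) (simp add: vs_def)
qed

text \<open>The length and distinctness of \<open>gs\<close> make it a Hamiltonian cycle; this
  alone, for one length, yields every even length four dimensions higher.\<close>

lemma BSQ_step_cycle:
  assumes gs: "vertex_cycle (bsq_adj n) gs" "length gs = 2 ^ n" "set gs \<subseteq> {v. length v = n}"
      "drop 4 u \<in> set gs"
    and "2 \<le> n" "length u = n + 4" "even l" "4 \<le> l" "l \<le> 2 ^ (n + 4)"
  shows "\<exists>vs. vertex_cycle (bsq_adj (n + 4)) vs \<and> length vs = l \<and> u \<in> set vs \<and>
           set vs \<subseteq> {v. length v = n + 4}"
proof -
  have "take 4 u \<in> set prefix_cycle"
    using assms(6) by (simp add: set_prefix_cycle)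
  then obtain ps0 where "vertex_cycle (bsq_cross 4) (take 4 u # ps0)"
    "length (take 4 u # ps0) = 16" "set (take 4 u # ps0) = {p. length p = 4}"
    using vertex_cycle_rotate_to[OF vertex_cycle_prefix_cycle]
    unfolding set_prefix_cycle length_prefix_cycle by metis
  then obtain ps where ps: "vertex_cycle (bsq_cross 4) ps" "length ps = 16"
      "set ps = {p. length p = 4}" "ps ! 0 = take 4 u"
    by (metis nth_Cons_0)
  obtain ss0 where "vertex_cycle (bsq_adj n) (drop 4 u # ss0)"
    "length (drop 4 u # ss0) = 2 ^ n" "set (drop 4 u # ss0) \<subseteq> {v. length v = n}"
    using vertex_cycle_rotate_to[OF gs(1,4)] gs(2,3) by metis
  then obtain ss where ss: "vertex_cycle (bsq_adj n) ss" "length ss = 2 ^ n"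
      "set ss \<subseteq> {v. length v = n}" "ss ! 0 = drop 4 u"
    by (metis nth_Cons_0)
  have len_p: "length (ps ! i) = 4" if "i < 16" for i
    using that ps(2,3) nth_mem[of i ps] by auto
  have len_s: "length (ss ! j) = n" if "j < 2 ^ n" for j
    using that ss(2,3) nth_mem[of j ss] by (auto simp del: nth_mem)
  have adj_p: "bsq_cross 4 (ps ! i) (ps ! Suc i)" if "Suc i < 16" for i
    using ps(1,2) that unfolding vertex_cycle_def successively_append_iff
    by (simp add: successively_nth)
  have adj_s: "bsq_adj n (ss ! j) (ss ! Suc j)" if "Suc j < 2 ^ n" for j
    using ss(1,2) that unfolding vertex_cycle_def successively_append_iff
    by (simp add: successively_nth)
  have "(2 :: nat) ^ 2 \<le> 2 ^ n" using assms(5) by (intro power_increasing) auto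
  then have "3 \<le> (2 :: nat) ^ n" by simp
  moreover have "l \<le> 2 * 8 * 2 ^ n" using assms(9) by (simp add: power_add)
  ultimately obtain vs where
    vs: "vertex_cycle grid_adj vs" "length vs = l" "(0, 0) \<in> set vs"
      "set vs \<subseteq> {..<2 * 8} \<times> {..<2 ^ n}"
    using grid_even_cycle[of "2 ^ n" l 8] assms(7,8) by blast
  \<comment> \<open>Row \<open>i\<close> selects a prefix and column \<open>j\<close> a suffix; both
    lists start at the coordinates of \<open>u\<close>, so the corner is sent to
    \<open>u\<close>.\<close>
  define f where "f = (\<lambda>(i, j). ps ! i @ ss ! j)"
  have range: "i < 16" "j < 2 ^ n" if "(i, j) \<in> set vs" for i j
    using that vs(4) by auto
  have inj: "inj_on f (set vs)"
  proof (rule inj_onI)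
    fix x y assume xy: "x \<in> set vs" "y \<in> set vs" "f x = f y"
    obtain i j i' j' where ij: "x = (i, j)" "y = (i', j')" by fastforce
    note bounds = range[OF xy(1)[unfolded ij]] range[OF xy(2)[unfolded ij]]
    have "ps ! i = ps ! i'" "ss ! j = ss ! j'"
      using xy(3) bounds by (auto simp: f_def ij len_p)
    moreover have "distinct ps" "distinct ss"
      using ps(1) ss(1) by (auto simp: vertex_cycle_def)
    ultimately show "x = y"
      using bounds ps(2) ss(2) by (auto simp: ij nth_eq_iff_index_eq)
  qed
  have edge: "bsq_adj (n + 4) (f x) (f y)"
    if "x \<in> set vs" "y \<in> set vs" "grid_adj x y" for x y
  proof -
    obtain i j i' j' where ij: "x = (i, j)" "y = (i', j')" by fastforce
    note bounds = range[OF that(1)[unfolded ij]] range[OF that(2)[unfolded ij]]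
    consider "i = i'" "j' = Suc j" | "i = i'" "j = Suc j'" | "j = j'" "i' = Suc i"
      | "j = j'" "i = Suc i'"
      using \<open>grid_adj x y\<close> unfolding ij by auto
    then show ?thesis
    proof cases
      case 1
      then show ?thesis
        using bounds by (simp add: f_def ij bsq_adj_append_same len_p adj_s)
    next
      case 2
      then show ?thesis
        using bounds by (simp add: f_def ij bsq_adj_append_same len_p adj_s bsq_adj_sym)
    next
      case 3
      then show ?thesis
        using bounds by (simp add: f_def ij bsq_adj_append_cross len_p len_s adj_p)
    next
      case 4
      then show ?thesis
        using bounds
        by (simp add: f_def ij bsq_adj_append_cross len_p len_s bsq_cross_sym[OF adj_p])
    qed
  qed
  have "f (0, 0) = u"
    using ps(4) ss(4) by (simp add: f_def)
  then have "u \<in> set (map f vs)"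
    using vs(3) by force
  moreover have "set (map f vs) \<subseteq> {v. length v = n + 4}"
    using range by (auto simp: f_def len_p len_s)
  ultimately show ?thesis
    using vertex_cycle_map[where f = f and S = "bsq_adj (n + 4)", OF vs(1) inj edge] vs(2)
    by (intro exI[of _ "map f vs"]) simp
qed

lemma BSQ_even_cycle:
  assumes "n mod 4 = 2" "length u = n" "even l" "4 \<le> l" "l \<le> 2 ^ n"
  shows "\<exists>vs. vertex_cycle (bsq_adj n) vs \<and> length vs = l \<and> u \<in> set vs \<and>
           set vs \<subseteq> {v. length v = n}"
  using assms
proof (induction n arbitrary: u l rule: less_induct)
  case (less n)
  show ?case
  proof (cases "n = 2")
    case True
    then have "l = 4" using less.prems by simp
    then show ?thesis using True BSQ_2_cycle less.prems(2) by blast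
  next
    case False
    obtain m where n: "n = m + 4"
      using less.prems(1) False by (metis add.commute le_Suc_ex mod_less not_le)
    have m: "m mod 4 = 2" using less.prems(1) by (simp add: n)
    then have m2: "2 \<le> m" by (metis mod_less_eq_dividend)
    have "(2 :: nat) ^ 2 \<le> 2 ^ m" using m2 by (intro power_increasing) auto
    moreover have "even ((2 :: nat) ^ m)" using m2 by simp
    \<comment> \<open>The induction hypothesis is invoked at the maximal length
      \<open>2 ^ m\<close>, giving a Hamiltonian cycle.\<close>
    ultimately obtain gs where "vertex_cycle (bsq_adj m) gs" "length gs = 2 ^ m"
      "drop 4 u \<in> set gs" "set gs \<subseteq> {v. length v = m}"
      using less.IH[of m "drop 4 u" "2 ^ m"] m less.prems(2) by (auto simp: n)
    then show ?thesis
      using BSQ_step_cycle[of m gs u l] m2 less.prems by (simp add: n)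
  qed
qed

theorem theorem10:
  fixes n :: nat
  assumes "n \<ge> 2" and "n mod 4 = 2"
  shows "vertex_bipancyclic (with_proj (BSQ n))"
  unfolding vertex_bipancyclic_def card_verts_BSQ
proof (intro ballI allI impI)
  fix u and l :: nat assume "u \<in> verts (with_proj (BSQ n))" and l: "even l \<and> 4 \<le> l \<and> l \<le> 2 ^ n"
  then have "length u = n" by (simp add: BSQ_def)
  with assms(2) l obtain vs where
    vs: "vertex_cycle (bsq_adj n) vs" "length vs = l" "u \<in> set vs" "set vs \<subseteq> {v. length v = n}"
    using BSQ_even_cycle by blast
  \<comment> \<open>Mapping by \<open>id\<close> only changes the relation, from
    \<open>bsq_adj n\<close> to membership in the arc set.\<close>
  have "vertex_cycle (\<lambda>x y. (x, y) \<in> parcs (BSQ n)) (map id vs)"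
    using vs(4) by (intro vertex_cycle_map[OF vs(1)]) (auto simp: BSQ_def)
  then have "pre_digraph.cycle (with_proj (BSQ n)) (vwalk_arcs (vs @ [hd vs]))"
    using vs(4) by (intro cycle_vwalk_arcs) (auto simp: BSQ_def)
  moreover have "length (vwalk_arcs (vs @ [hd vs])) = l"
    using vwalk_length_simp[of "vs @ [hd vs]"] vs(2)
    unfolding vwalk_length_def by simp
  ultimately show "\<exists>p. pre_digraph.cycle (with_proj (BSQ n)) p \<and> length p = l \<and>
      u \<in> tail (with_proj (BSQ n)) ` set p"
    using vs(3) fst_set_vwalk_arcs[of vs "hd vs"] by auto
qed

end
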